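(* Let $\varphi = \forall \pi_1 \dots \forall \pi_n \mathpunct{.} \psi$ be a HyperLTL formula, where $\psi$ is an LTL formula over the trace variables $\{\pi_1, \dots, \pi_n\}$. Then $\varphi$ is symmetric if and only if the HyperLTL formula \[ \varphi_\mathit{symm} = \exists \pi_1 \dots \exists \pi_n \mathpunct{.} \big(\psi(\pi_1, \pi_2, \dots, \pi_{n-1}, \pi_n) \nleftrightarrow \psi(\pi_2, \pi_1, \dots, \pi_{n-1}, \pi_n)\big) \vee \big(\psi(\pi_1, \pi_2, \dots, \pi_{n-1}, \pi_n) \nleftrightarrow \psi(\pi_2, \pi_3, \dots, \pi_n, \pi_1)\big) \] is unsatisfiable.
   Context: Let $AP$ be a set of atomic propositions and $\Sigma = 2^{AP}$; traces are infinite words in $\Sigma^\omega$. A HyperLTL formula has the form $Q_1\pi_1\dots Q_n\pi_n\mathpunct{.}\psi$ with $Q_i\in\{\forall,\exists\}$, trace variables $\pi_i$ from a set $\mathcal{V}$, and $\psi$ an LTL formula whose atomic propositions are of the form $a_\pi$ ($a\in AP$, $\pi$ a trace variable), meaning that $a$ holds at the current position of the trace assigned to $\pi$. For a set of traces $T$ and an assignment $\Pi:\mathcal{V}\to T$, $\Pi\models_T\psi$ is the usual LTL semantics evaluated synchronously on the traces $\Pi(\pi)$; quantifiers range over $T$. A HyperLTL formula is satisfiable if some nonempty set of traces satisfies it. The notation $\psi(\pi_{i_1},\dots,\pi_{i_n})$ denotes $\psi$ with each $\pi_j$ simultaneously replaced by $\pi_{i_j}$; $\nleftrightarrow$ denotes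 exclusive or (negated equivalence). $\varphi$ is invariant under a trace variable permutation $\sigma:\mathcal{V}\to\mathcal{V}$ if for every set of traces $T\subseteq\Sigma^\omega$ and every assignment $\Pi:\mathcal{V}\to T$, $\Pi\models_T\psi \Leftrightarrow (\Pi\circ\sigma)\models_T\psi$. $\varphi$ is symmetric if it is invariant under every trace variable permutation of $\mathcal{V}=\{\pi_1,\dots,\pi_n\}$. *)

theory Defs
  imports Main "HOL-Library.FuncSet" "HOL-Combinatorics.Permutations"
begin

type_synonym 'ap trace = "nat \<Rightarrow> 'ap set"

text \<open>\<open>Prop a x\<close> is the indexed proposition \<open>a\<^sub>x\<close>. The map function \<open>map_ltl\<close> renames atomic
  propositions and trace variables.\<close>

datatype (ltl_props: 'ap, ltl_tvars: 'v) ltl =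
    TrueL
  | Prop 'ap 'v
  | NotL "('ap, 'v) ltl"
  | AndL "('ap, 'v) ltl" "('ap, 'v) ltl"
  | OrL "('ap, 'v) ltl" "('ap, 'v) ltl"
  | NextL "('ap, 'v) ltl"
  | UntilL "('ap, 'v) ltl" "('ap, 'v) ltl"
  for map: map_ltl

definition ImpL :: "('ap, 'v) ltl \<Rightarrow> ('ap, 'v) ltl \<Rightarrow> ('ap, 'v) ltl" where
  "ImpL p q = OrL (NotL p) q"

definition IffL :: "('ap, 'v) ltl \<Rightarrow> ('ap, 'v) ltl \<Rightarrow> ('ap, 'v) ltl" where
  "IffL p q = AndL (ImpL p q) (ImpL q p)"

definition XorL :: "('ap, 'v) ltl \<Rightarrow> ('ap, 'v) ltl \<Rightarrow> ('ap, 'v) ltl" where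
  "XorL p q = NotL (IffL p q)"

primrec ltl_sat :: "('v \<Rightarrow> 'ap trace) \<Rightarrow> nat \<Rightarrow> ('ap, 'v) ltl \<Rightarrow> bool" where
  "ltl_sat A i TrueL \<longleftrightarrow> True"
| "ltl_sat A i (Prop a x) \<longleftrightarrow> a \<in> A x i"
| "ltl_sat A i (NotL p) \<longleftrightarrow> \<not> ltl_sat A i p"
| "ltl_sat A i (AndL p q) \<longleftrightarrow> ltl_sat A i p \<and> ltl_sat A i q"
| "ltl_sat A i (OrL p q) \<longleftrightarrow> ltl_sat A i p \<or> ltl_sat A i q"
| "ltl_sat A i (NextL p) \<longleftrightarrow> ltl_sat A (Suc i) p"
| "ltl_sat A i (UntilL p q) \<longleftrightarrow>
     (\<exists>j\<ge>i. ltl_sat A j q \<and> (\<forall>k. i \<le> k \<and> k < j \<longrightarrow> ltl_sat A k p))"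

datatype quant = Forall | Exists

datatype ('ap, 'v) hyperltl =
  HyperLTL (quant_prefix: "(quant \<times> 'v) list") (body: "('ap, 'v) ltl")

definition trace_vars :: "('ap, 'v) hyperltl \<Rightarrow> 'v set" where
  "trace_vars \<phi> = snd ` set (quant_prefix \<phi>)"

fun prefix_sat :: "'ap trace set \<Rightarrow> ('v \<Rightarrow> 'ap trace) \<Rightarrow> (quant \<times> 'v) list \<Rightarrow> ('ap, 'v) ltl \<Rightarrow> bool"
where
  "prefix_sat T A [] \<psi> \<longleftrightarrow> ltl_sat A 0 \<psi>"
| "prefix_sat T A ((Forall, x) # qs) \<psi> \<longleftrightarrow> (\<forall>t\<in>T. prefix_sat T (A(x := t)) qs \<psi>)"
| "prefix_sat T A ((Exists, x) # qs) \<psi> \<longleftrightarrow> (\<exists>t\<in>T. prefix_sat T (A(x := t)) qs \<psi>)"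

text \<open>Assignments with domain \<open>V\<close> are the extensional functions on \<open>V\<close>, hence \<open>\<lambda>_. undefined\<close> is the
  empty assignment.\<close>

definition models :: "'ap trace set \<Rightarrow> ('ap, 'v) hyperltl \<Rightarrow> bool" where
  "models T \<phi> \<longleftrightarrow> prefix_sat T (\<lambda>_. undefined) (quant_prefix \<phi>) (body \<phi>)"

definition satisfiable :: "('ap, 'v) hyperltl \<Rightarrow> bool" where
  "satisfiable \<phi> \<longleftrightarrow> (\<exists>T. T \<noteq> {} \<and> models T \<phi>)"

definition invariant_under :: "('ap, 'v) hyperltl \<Rightarrow> ('v \<Rightarrow> 'v) \<Rightarrow> bool" where
  "invariant_under \<phi> \<sigma> \<longleftrightarrow>
     (\<forall>T. \<forall>A \<in> trace_vars \<phi> \<rightarrow>\<^sub>E T. ltl_sat A 0 (body \<phi>) \<longleftrightarrow> ltl_sat (A \<circ> \<sigma>) 0 (body \<phi>))"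

definition symmetric :: "('ap, 'v) hyperltl \<Rightarrow> bool" where
  "symmetric \<phi> \<longleftrightarrow> (\<forall>\<sigma>. \<sigma> permutes trace_vars \<phi> \<longrightarrow> invariant_under \<phi> \<sigma>)"

text \<open>From here on the trace variable \<open>\<pi>\<^sub>j\<close> is the number \<open>j \<in> {1..n}\<close>.\<close>

definition forall_closure :: "nat \<Rightarrow> ('ap, nat) ltl \<Rightarrow> ('ap, nat) hyperltl" where
  "forall_closure n \<psi> = HyperLTL (map (\<lambda>j. (Forall, j)) [1..<n+1]) \<psi>"

definition exists_closure :: "nat \<Rightarrow> ('ap, nat) ltl \<Rightarrow> ('ap, nat) hyperltl" where
  "exists_closure n \<psi> = HyperLTL (map (\<lambda>j. (Exists, j)) [1..<n+1]) \<psi>"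

text \<open>\<open>inst \<psi> [i\<^sub>1, \<dots>, i\<^sub>n]\<close> is \<open>\<psi>(\<pi>\<^bsub>i\<^sub>1\<^esub>, \<dots>, \<pi>\<^bsub>i\<^sub>n\<^esub>)\<close>; list positions start at 0.\<close>

definition inst :: "('ap, nat) ltl \<Rightarrow> nat list \<Rightarrow> ('ap, nat) ltl" where
  "inst \<psi> js = map_ltl id (\<lambda>j. if 1 \<le> j \<and> j \<le> length js then js ! (j - 1) else j) \<psi>"

text \<open>The tuple \<open>(\<pi>\<^sub>2, \<pi>\<^sub>1, \<pi>\<^sub>3, \<dots>, \<pi>\<^sub>n)\<close> needs \<open>n \<ge> 2\<close>; with fewer variables there is nothing to swap.\<close>

definition swap_vars :: "nat \<Rightarrow> nat list" where
  "swap_vars n = (if n \<ge> 2 then 2 # 1 # [3..<n+1] else [1..<n+1])"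

definition rotate_vars :: "nat \<Rightarrow> nat list" where
  "rotate_vars n = [2..<n+1] @ [1]"

definition symm_formula :: "nat \<Rightarrow> ('ap, nat) ltl \<Rightarrow> ('ap, nat) hyperltl" where
  "symm_formula n \<psi> = exists_closure n
     (OrL (XorL (inst \<psi> [1..<n+1]) (inst \<psi> (swap_vars n)))
          (XorL (inst \<psi> [1..<n+1]) (inst \<psi> (rotate_vars n))))"

end

theory Submission imports Defs begin

text \<open>The permutations under which \<open>\<psi>\<close> is invariant form a group, so it suffices that the
  transposition \<open>(1 2)\<close> and the cycle \<open>(1 2 \<dots> n)\<close> generate all permutations of \<open>{1..n}\<close>:
  conjugating \<open>(1 2)\<close> by powers of the cycle yields the adjacent transpositions, and conjugating
  those by each other yields all transpositions.\<close>

text \<open>The cycle (1 2 ... n), extended by the identity so that it permutes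
  \<open>{1..n}\<close>; for n \<le> 1 it is the identity.\<close>

definition rotation :: "nat \<Rightarrow> nat \<Rightarrow> nat" where
  "rotation n j = (if j < 1 \<or> n < j then j else if j = n then 1 else Suc j)"

lemma rotation_permutes: "rotation n permutes {1..n}"
proof (rule bij_imp_permutes)
  have inj: "inj_on (rotation n) {1..n}"
    by (auto simp: inj_on_def rotation_def split: if_splits)
  moreover have "rotation n ` {1..n} \<subseteq> {1..n}"
    by (auto simp: rotation_def)
  ultimately show "bij_betw (rotation n) {1..n} {1..n}"
    by (simp add: bij_betw_def endo_inj_surj)
qed (auto simp: rotation_def)

text \<open>Injectivity of \<open>f\<close> makes it intertwine the two transpositions; surjectivity
  then cancels \<open>f\<close> against \<open>inv f\<close>.\<close>

lemma transpose_conjugate: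
  assumes "bij f"
  shows "f \<circ> transpose a b \<circ> inv f = transpose (f a) (f b)"
proof -
  have "f \<circ> transpose a b = transpose (f a) (f b) \<circ> f"
    using assms by (auto simp: fun_eq_iff transpose_def bij_def inj_eq)
  then show ?thesis
    using assms by (simp add: comp_assoc surj_iff[THEN iffD1, OF bij_is_surj])
qed

text \<open>Shaped as an induction rule, with \<open>G\<close> in the role of membership in a group.
  The case \<open>swap\<close> is conditional because (1 2) permutes \<open>{1..n}\<close> only for
  n \<ge> 2.\<close>

lemma permutes_generated_by_swap_rotation [consumes 1, case_names id comp inv swap rotation]:
  assumes perm: "\<sigma> permutes {1..n}"
    and id: "G id"
    and comp: "\<And>p q. G p \<Longrightarrow> G q \<Longrightarrow> G (p \<circ> q)"
    and inv: "\<And>p. bij p \<Longrightarrow> G p \<Longrightarrow> G (inv p)"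
    and swap: "2 \<le> n \<Longrightarrow> G (transpose 1 2)"
    and rotation: "G (rotation n)"
  shows "G \<sigma>"
proof -
  have conj: "G (transpose (f a) (f b))" if "bij f" "G f" "G (transpose a b)" for f a b
    unfolding transpose_conjugate[OF that(1), symmetric] by (intro comp inv that)
  have adjacent: "G (transpose k (Suc k))" if "1 \<le> k" "k < n" for k
    using that
  proof (induction k rule: dec_induct)
    case base
    then show ?case using swap by (simp add: numeral_2_eq_2)
  next
    case (step k)
    \<comment> \<open>Here \<open>Suc k < n\<close>, so neither point wraps around: the pair k, k+1
      moves to k+1, k+2.\<close>
    then have "G (transpose (rotation n k) (rotation n (Suc k)))"
      using conj[OF permutes_bij[OF rotation_permutes] rotation] by simp
    then show ?case using step by (simp add: rotation_def)
  qed
  have less: "G (transpose a b)" if "1 \<le> a" "Suc a \<le> b" "b \<le> n" for a b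
    using that(2,3)
  proof (induction b rule: dec_induct)
    case base
    then show ?case using adjacent that by simp
  next
    case (step b)
    \<comment> \<open>Conjugation by (b b+1) fixes a, since a < b, and moves b to b+1, turning (a b)
      into (a b+1).\<close>
    then have "G (transpose (transpose b (Suc b) a) (transpose b (Suc b) b))"
      using that by (intro conj[of "transpose b (Suc b)"] adjacent) auto
    then show ?case using step by simp
  qed
  have transp: "G (transpose a b)" if "a \<in> {1..n}" "b \<in> {1..n}" for a b
  proof (cases a b rule: linorder_cases)
    case greater
    then show ?thesis using less[of b a] that by (simp add: transpose_commute)
  qed (use less[of a b] that id in \<open>auto simp: id_def\<close>)
  from perm have "\<sigma> permutes {1..n}" "finite {1..n}" by simp_all
  then show ?thesis
  proof (induction rule: permutes_induct)
    case id
    then show ?case using \<open>G id\<close> by (simp add: id_def)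
  next
    case (swap a b p)
    then show ?case by (intro comp transp) auto
  qed
qed

text \<open>A renamed atom reads the trace \<open>A (f x)\<close>. This links syntactic
  instantiation to the permuted assignments in the definition of symmetry.\<close>

lemma ltl_sat_map: "ltl_sat A i (map_ltl id f \<psi>) \<longleftrightarrow> ltl_sat (A \<circ> f) i \<psi>"
  by (induction \<psi> arbitrary: i) simp_all

lemma ltl_sat_cong:
  "(\<And>x. x \<in> ltl_tvars \<psi> \<Longrightarrow> A x = B x) \<Longrightarrow> ltl_sat A i \<psi> \<longleftrightarrow> ltl_sat B i \<psi>"
proof (induction \<psi> arbitrary: i)
  case (UntilL p q)
  then have "ltl_sat A j p = ltl_sat B j p" "ltl_sat A j q = ltl_sat B j q" for j
    by simp_all
  then show ?case by simp
qed auto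

lemma ltl_sat_XorL [simp]: "ltl_sat A i (XorL p q) \<longleftrightarrow> ltl_sat A i p \<noteq> ltl_sat A i q"
  by (auto simp: XorL_def IffL_def ImpL_def)

lemma ltl_sat_inst:
  assumes "ltl_tvars \<psi> \<subseteq> {1..n}" "n \<le> length js"
    and "\<And>j. 1 \<le> j \<Longrightarrow> j \<le> n \<Longrightarrow> js ! (j - 1) = f j"
  shows "ltl_sat A i (inst \<psi> js) \<longleftrightarrow> ltl_sat (A \<circ> f) i \<psi>"
  unfolding inst_def ltl_sat_map
proof (rule ltl_sat_cong)
  fix j assume "j \<in> ltl_tvars \<psi>"
  then have "1 \<le> j" "j \<le> n" using assms(1) by auto
  then show "(A \<circ> (\<lambda>j. if 1 \<le> j \<and> j \<le> length js then js ! (j - 1) else j)) j = (A \<circ> f) j"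
    using assms(2) assms(3)[of j] by simp
qed

lemma ltl_sat_inst_id:
  assumes "ltl_tvars \<psi> \<subseteq> {1..n}"
  shows "ltl_sat A i (inst \<psi> [1..<n+1]) \<longleftrightarrow> ltl_sat A i \<psi>"
  using ltl_sat_inst[OF assms, of "[1..<n+1]" id] by (simp del: upt_Suc)

lemma ltl_sat_inst_swap:
  assumes "ltl_tvars \<psi> \<subseteq> {1..n}"
  shows "ltl_sat A i (inst \<psi> (swap_vars n)) \<longleftrightarrow>
    ltl_sat (if 2 \<le> n then A \<circ> transpose 1 2 else A) i \<psi>"
proof (cases "2 \<le> n")
  case True
  have "swap_vars n ! (j - 1) = transpose 1 2 j" if "1 \<le> j" "j \<le> n" for j
  proof -
    \<comment> \<open>The cases follow the list \<open>2 # 1 # [3..<n+1]\<close>, whose tail holds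
      each j \<ge> 3 at its own position j-1.\<close>
    consider "j = 1" | "j = 2" | "3 \<le> j"
      using \<open>1 \<le> j\<close> by fastforce
    then show ?thesis using True that
      by cases (auto simp: swap_vars_def transpose_def nth_Cons' simp del: upt_Suc)
  qed
  then show ?thesis
    using True ltl_sat_inst[OF assms, of "swap_vars n" "transpose 1 2"]
    by (simp add: swap_vars_def del: upt_Suc)
next
  case False
  then show ?thesis
    using ltl_sat_inst_id[OF assms] by (simp add: swap_vars_def del: upt_Suc)
qed

lemma ltl_sat_inst_rotate:
  assumes "ltl_tvars \<psi> \<subseteq> {1..n}"
  shows "ltl_sat A i (inst \<psi> (rotate_vars n)) \<longleftrightarrow> ltl_sat (A \<circ> rotation n) i \<psi>"
proof (rule ltl_sat_inst[OF assms])
  \<comment> \<open>Only an inequality holds in general: for n = 0 the list is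
    \<open>[1]\<close>.\<close>
  show "n \<le> length (rotate_vars n)"
    by (auto simp: rotate_vars_def simp del: upt_Suc)
  show "rotate_vars n ! (j - 1) = rotation n j" if "1 \<le> j" "j \<le> n" for j
    using that by (auto simp: rotate_vars_def rotation_def nth_append simp del: upt_Suc)
qed

text \<open>A block of existential quantifiers amounts to choosing one assignment \<open>B\<close>
  at once; \<open>A\<close> stays arbitrary because each quantifier updates it.\<close>

lemma prefix_sat_Exists:
  "prefix_sat T A (map (\<lambda>x. (Exists, x)) xs) \<psi> \<longleftrightarrow>
    (\<exists>B. (\<forall>x\<in>set xs. B x \<in> T) \<and> (\<forall>x. x \<notin> set xs \<longrightarrow> B x = A x) \<and> ltl_sat B 0 \<psi>)"
proof (induction xs arbitrary: A)
  case Nil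
  have "(\<forall>x. B x = A x) \<longleftrightarrow> B = A" for B by auto
  then show ?case by simp
next
  case (Cons y ys)
  show ?case (is "?L \<longleftrightarrow> ?R")
  proof
    assume ?L
    then obtain t B where "t \<in> T" "\<forall>x\<in>set ys. B x \<in> T"
      "\<forall>x. x \<notin> set ys \<longrightarrow> B x = (A(y := t)) x" "ltl_sat B 0 \<psi>"
      by (auto simp: Cons.IH)
    then show ?R by (intro exI[of _ B]) (auto split: if_splits)
  next
    assume ?R
    then obtain B where "\<forall>x\<in>set (y # ys). B x \<in> T"
      "\<forall>x. x \<notin> set (y # ys) \<longrightarrow> B x = A x" "ltl_sat B 0 \<psi>"
      by blast
    \<comment> \<open>Once \<open>B y\<close> is chosen for y, \<open>B\<close> itself serves the
      remaining variables.\<close>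
    then show ?L by (auto simp: Cons.IH intro!: bexI[of _ "B y"] exI[of _ B])
  qed
qed

lemma satisfiable_exists_closure:
  assumes "ltl_tvars \<psi> \<subseteq> {1..n}"
  shows "satisfiable (exists_closure n \<psi>) \<longleftrightarrow> (\<exists>A. ltl_sat A 0 \<psi>)"
proof
  show "\<exists>A. ltl_sat A 0 \<psi>" if "satisfiable (exists_closure n \<psi>)"
    using that
    by (auto simp: satisfiable_def models_def exists_closure_def prefix_sat_Exists simp del: upt_Suc)
next
  assume "\<exists>A. ltl_sat A 0 \<psi>"
  then obtain A where A: "ltl_sat A 0 \<psi>" by blast
  \<comment> \<open>Evaluation starts from the everywhere \<open>undefined\<close> assignment, so
    the witness must be \<open>undefined\<close> outside \<open>{1..n}\<close>. With
    \<open>UNIV\<close> as trace set, every choice of traces is available.\<close>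
  have "ltl_sat (restrict A {1..n}) 0 \<psi>"
    using A ltl_sat_cong[of \<psi> "restrict A {1..n}" A 0] assms
    by (metis restrict_apply' subsetD)
  then have "models UNIV (exists_closure n \<psi>)"
    by (auto simp: models_def exists_closure_def prefix_sat_Exists simp del: upt_Suc
        intro!: exI[of _ "restrict A {1..n}"])
  then show "satisfiable (exists_closure n \<psi>)"
    by (auto simp: satisfiable_def)
qed

text \<open>Invariance over \<open>UNIV\<close> covers every trace set, and restricting an
  assignment to \<open>{1..n}\<close> does not affect the truth of \<open>\<psi>\<close>.\<close>

lemma symmetric_forall_closure:
  fixes \<psi> :: "('a, nat) ltl"
  assumes "ltl_tvars \<psi> \<subseteq> {1..n}"
  shows "symmetric (forall_closure n \<psi>) \<longleftrightarrow>
    (\<forall>\<sigma>. \<sigma> permutes {1..n} \<longrightarrow> (\<forall>A. ltl_sat A 0 \<psi> \<longleftrightarrow> ltl_sat (A \<circ> \<sigma>) 0 \<psi>))"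
proof -
  have vars: "trace_vars (forall_closure n \<psi>) = {1..n}"
    by (auto simp: trace_vars_def forall_closure_def image_image simp del: upt_Suc)
  have "invariant_under (forall_closure n \<psi>) \<sigma> \<longleftrightarrow>
      (\<forall>A. ltl_sat A 0 \<psi> \<longleftrightarrow> ltl_sat (A \<circ> \<sigma>) 0 \<psi>)" (is "?L \<longleftrightarrow> ?R")
    if \<sigma>: "\<sigma> permutes {1..n}" for \<sigma>
  proof
    assume ?L
    show ?R
    proof
      fix A :: "nat \<Rightarrow> 'a trace"
      let ?A = "restrict A {1..n}"
      have "ltl_sat ?A 0 \<psi> \<longleftrightarrow> ltl_sat (?A \<circ> \<sigma>) 0 \<psi>"
        using \<open>?L\<close> unfolding invariant_under_def vars
        by (auto simp: forall_closure_def dest!: spec[of _ UNIV] bspec[of _ _ ?A])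
      moreover have "ltl_sat ?A 0 \<psi> \<longleftrightarrow> ltl_sat A 0 \<psi>"
        using assms by (intro ltl_sat_cong) auto
      moreover have "ltl_sat (?A \<circ> \<sigma>) 0 \<psi> \<longleftrightarrow> ltl_sat (A \<circ> \<sigma>) 0 \<psi>"
      proof (rule ltl_sat_cong)
        fix x assume "x \<in> ltl_tvars \<psi>"
        then have "\<sigma> x \<in> {1..n}" using assms permutes_in_image[OF \<sigma>] by blast
        then show "(?A \<circ> \<sigma>) x = (A \<circ> \<sigma>) x" by simp
      qed
      ultimately show "ltl_sat A 0 \<psi> \<longleftrightarrow> ltl_sat (A \<circ> \<sigma>) 0 \<psi>" by blast
    qed
  next
    assume ?R
    then show ?L by (simp add: invariant_under_def forall_closure_def)
  qed
  then show ?thesis by (auto simp: symmetric_def vars)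
qed

text \<open>The bound \<open>max 1 n\<close> admits \<open>rotate_vars 0 = [1]\<close>; as soon as
  some variable occurs in \<open>\<psi>\<close>, n \<ge> 1 and the bound is n.\<close>

lemma ltl_tvars_inst:
  assumes "ltl_tvars \<psi> \<subseteq> {1..n}" "set js \<subseteq> {1..max 1 n}" "n \<le> length js"
  shows "ltl_tvars (inst \<psi> js) \<subseteq> {1..n}"
proof
  fix x assume "x \<in> ltl_tvars (inst \<psi> js)"
  then obtain j where j: "j \<in> ltl_tvars \<psi>"
    "x = (if 1 \<le> j \<and> j \<le> length js then js ! (j - 1) else j)"
    by (auto simp: inst_def ltl.set_map)
  then have "1 \<le> j" "j \<le> n" using assms by auto
  then have "x \<in> set js" using j assms(3) by auto
  then show "x \<in> {1..n}" using assms(2) \<open>1 \<le> j\<close> \<open>j \<le> n\<close> by auto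
qed

lemma satisfiable_symm_formula:
  assumes "ltl_tvars \<psi> \<subseteq> {1..n}"
  shows "satisfiable (symm_formula n \<psi>) \<longleftrightarrow>
    (\<exists>A. (2 \<le> n \<and> ltl_sat A 0 \<psi> \<noteq> ltl_sat (A \<circ> transpose 1 2) 0 \<psi>) \<or>
      ltl_sat A 0 \<psi> \<noteq> ltl_sat (A \<circ> rotation n) 0 \<psi>)"
proof -
  have "ltl_tvars (inst \<psi> [1..<n+1]) \<subseteq> {1..n}" "ltl_tvars (inst \<psi> (swap_vars n)) \<subseteq> {1..n}"
    "ltl_tvars (inst \<psi> (rotate_vars n)) \<subseteq> {1..n}"
    by (rule ltl_tvars_inst[OF assms];
        auto simp: swap_vars_def rotate_vars_def simp del: upt_Suc)+
  then have "ltl_tvars (OrL (XorL (inst \<psi> [1..<n+1]) (inst \<psi> (swap_vars n)))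
      (XorL (inst \<psi> [1..<n+1]) (inst \<psi> (rotate_vars n)))) \<subseteq> {1..n}"
    by (simp add: XorL_def IffL_def ImpL_def del: upt_Suc)
  from satisfiable_exists_closure[OF this] show ?thesis
    unfolding symm_formula_def ltl_sat.simps ltl_sat_XorL
      ltl_sat_inst_id[OF assms] ltl_sat_inst_swap[OF assms] ltl_sat_inst_rotate[OF assms]
    \<comment> \<open>For n < 2 the first exclusive or compares \<open>\<psi>\<close> with itself
      and is false.\<close>
    by (cases "2 \<le> n") simp_all
qed

theorem mainTheorem1:
  fixes n :: nat and \<psi> :: "('ap, nat) ltl"
  assumes "ltl_tvars \<psi> \<subseteq> {1..n}"
  shows "symmetric (forall_closure n \<psi>) \<longleftrightarrow> \<not> satisfiable (symm_formula n \<psi>)"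
proof
  assume "symmetric (forall_closure n \<psi>)"
  then have sym: "ltl_sat A 0 \<psi> \<longleftrightarrow> ltl_sat (A \<circ> \<sigma>) 0 \<psi>" if "\<sigma> permutes {1..n}" for A \<sigma>
    using that unfolding symmetric_forall_closure[OF assms] by blast
  have "transpose 1 2 permutes {1..n}" if "2 \<le> n"
    using that by (intro permutes_swap_id) auto
  then show "\<not> satisfiable (symm_formula n \<psi>)"
    using sym rotation_permutes unfolding satisfiable_symm_formula[OF assms] by blast
next
  assume "\<not> satisfiable (symm_formula n \<psi>)"
  then have transpose: "2 \<le> n \<Longrightarrow> \<forall>A. ltl_sat A 0 \<psi> \<longleftrightarrow> ltl_sat (A \<circ> transpose 1 2) 0 \<psi>"
    and rotation: "\<forall>A. ltl_sat A 0 \<psi> \<longleftrightarrow> ltl_sat (A \<circ> rotation n) 0 \<psi>"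
    unfolding satisfiable_symm_formula[OF assms] by blast+
  \<comment> \<open>Quantifying over all \<open>A\<close> gives the group closure: for a
    composition, invariance under \<open>q\<close> is used at \<open>A \<circ> p\<close>; for an
    inverse, invariance under \<open>p\<close> is used at \<open>A \<circ> inv p\<close>.\<close>
  have "\<forall>A. ltl_sat A 0 \<psi> \<longleftrightarrow> ltl_sat (A \<circ> \<sigma>) 0 \<psi>" if "\<sigma> permutes {1..n}" for \<sigma>
    using that
  proof (induction rule: permutes_generated_by_swap_rotation)
    case (comp p q)
    then show ?case by (metis comp_assoc)
  next
    case (inv p)
    then show ?case by (metis bij_is_inj comp_assoc comp_id inv_o_cancel)
  next
    case swap
    then show ?case by (rule transpose)
  qed (simp, rule rotation)
  then show "symmetric (forall_closure n \<psi>)"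
    unfolding symmetric_forall_closure[OF assms] by blast
qed

end
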